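(* Fix an integer $n\ge 3$. The sequence, indexed by the dimension $d$, of Rook's Walks with dimension $d$ and board length $n$ has cutoff at $\frac{d(n-1)}{2n}\log(d)$ with window $\frac{d(n-1)}{n}$. In other words, there exist functions $c_l,c_u:(0,1)\to\mathbb{R}$ that depend only on $\epsilon$ such that, for every $\epsilon\in(0,1)$ and all sufficiently large $d$, $$\frac{d(n-1)}{2n}\log(d)+c_l(\epsilon)\frac{d(n-1)}{n}\;\le\; t_{\mathrm{mix}}(\epsilon)\;\le\;\frac{d(n-1)}{2n}\log(d)+c_u(\epsilon)\frac{d(n-1)}{n},$$ where $t_{\mathrm{mix}}(\epsilon)$ is the mixing time of the Rook's Walk with dimension $d$ and board length $n$.
   Context: The Rook's Walk with dimension $d$ and board length $n$ is the discrete-time Markov chain on $\Omega=\{1,\dots,n\}^d$ with transition matrix $P(x,y)=\frac{1}{d(n-1)}$ if $\|x-y\|_0=1$ and $P(x,y)=0$ otherwise, where $\|x-y\|_0$ is the Hamming distance. Its stationary distribution $\pi$ is uniform on $\Omega$. For distributions $\mu,\nu$ on a finite set $\Omega$, $\|\mu-\nu\|_{TV}=\frac12\sum_{x\in\Omega}|\mu(x)-\nu(x)|$. Put $d(t)=\max_{x\in\Omega}\|P^t(x,\cdot)-\pi\|_{TV}$ and $t_{\mathrm{mix}}(\epsilon)=\inf\{t\in\mathbb{Z}_{\ge 0} : d(t)\le\epsilon\}$. A family of chains with parameter $a$ is said to have cutoff at $F(a)$ with window $w(a)=o(F(a))$ if $F(a)+c_l(\epsilon)w(a)\le t_{\mathrm{mix}}(\epsilon)\le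 F(a)+c_u(\epsilon)w(a)$ for all sufficiently large parameter choices, where $c_l,c_u$ are functions depending only on $\epsilon$. Logarithms are natural. *)

theory Defs
  imports Complex_Main "HOL-Library.FuncSet" "HOL-Library.Extended_Real"
    "HOL-Library.Landau_Symbols"
begin

text \<open>Distributions on, and transition matrices over, a finite set \<open>\<Omega>\<close> are real-valued functions;
  only their values on \<open>\<Omega>\<close> matter.\<close>

definition tv_dist :: "'a set \<Rightarrow> ('a \<Rightarrow> real) \<Rightarrow> ('a \<Rightarrow> real) \<Rightarrow> real" where
  "tv_dist \<Omega> \<mu> \<nu> = (1/2) * (\<Sum>x\<in>\<Omega>. \<bar>\<mu> x - \<nu> x\<bar>)"

primrec trans_pow :: "'a set \<Rightarrow> ('a \<Rightarrow> 'a \<Rightarrow> real) \<Rightarrow> nat \<Rightarrow> 'a \<Rightarrow> 'a \<Rightarrow> real" where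
  "trans_pow \<Omega> P 0 = (\<lambda>x y. if x = y then 1 else 0)"
| "trans_pow \<Omega> P (Suc t) = (\<lambda>x y. \<Sum>z\<in>\<Omega>. trans_pow \<Omega> P t x z * P z y)"

definition dist_to_stat ::
    "'a set \<Rightarrow> ('a \<Rightarrow> 'a \<Rightarrow> real) \<Rightarrow> ('a \<Rightarrow> real) \<Rightarrow> nat \<Rightarrow> real" where
  "dist_to_stat \<Omega> P \<pi> t = Max ((\<lambda>x. tv_dist \<Omega> (trans_pow \<Omega> P t x) \<pi>) ` \<Omega>)"

text \<open>The infimum is taken in \<^typ>\<open>enat\<close>, so that it is \<open>\<infinity>\<close> if the level \<open>\<epsilon>\<close> is never reached.\<close>

definition mixing_time ::
    "'a set \<Rightarrow> ('a \<Rightarrow> 'a \<Rightarrow> real) \<Rightarrow> ('a \<Rightarrow> real) \<Rightarrow> real \<Rightarrow> enat" where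
  "mixing_time \<Omega> P \<pi> \<epsilon> = Inf (enat ` {t. dist_to_stat \<Omega> P \<pi> t \<le> \<epsilon>})"

text \<open>Here \<open>tmix a\<close> is the mixing time of the chain with parameter \<open>a\<close>, as a function of \<open>\<epsilon>\<close>.
  The functions \<open>cl\<close> and \<open>cu\<close> are used on the interval \<open>(0,1)\<close> only.\<close>

definition has_cutoff ::
    "(nat \<Rightarrow> real \<Rightarrow> enat) \<Rightarrow> (nat \<Rightarrow> real) \<Rightarrow> (nat \<Rightarrow> real) \<Rightarrow> bool" where
  "has_cutoff tmix F w \<longleftrightarrow>
     w \<in> o(F) \<and>
     (\<exists>cl cu :: real \<Rightarrow> real. \<forall>\<epsilon>\<in>{0<..<1}. \<forall>\<^sub>F a in sequentially.
        ereal (F a + cl \<epsilon> * w a) \<le> ereal_of_enat (tmix a \<epsilon>) \<and>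
        ereal_of_enat (tmix a \<epsilon>) \<le> ereal (F a + cu \<epsilon> * w a))"

definition rook_states :: "nat \<Rightarrow> nat \<Rightarrow> (nat \<Rightarrow> nat) set" where
  "rook_states d n = ({1..d} \<rightarrow>\<^sub>E {1..n})"

definition hamming_dist :: "nat \<Rightarrow> (nat \<Rightarrow> nat) \<Rightarrow> (nat \<Rightarrow> nat) \<Rightarrow> nat" where
  "hamming_dist d x y = card {i \<in> {1..d}. x i \<noteq> y i}"

definition rook_trans :: "nat \<Rightarrow> nat \<Rightarrow> (nat \<Rightarrow> nat) \<Rightarrow> (nat \<Rightarrow> nat) \<Rightarrow> real" where
  "rook_trans d n x y =
     (if hamming_dist d x y = 1 then 1 / (real d * (real n - 1)) else 0)"

definition rook_stat :: "nat \<Rightarrow> nat \<Rightarrow> (nat \<Rightarrow> nat) \<Rightarrow> real" where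
  "rook_stat d n x = 1 / real (card (rook_states d n))"

definition rook_mixing_time :: "nat \<Rightarrow> nat \<Rightarrow> real \<Rightarrow> enat" where
  "rook_mixing_time d n \<epsilon> =
     mixing_time (rook_states d n) (rook_trans d n) (rook_stat d n) \<epsilon>"

end

(* Let E_S(x,y) be the product over i in S of n [x_i = y_i] - 1. Each E_S(x,.) is an eigenfunction of P
   with eigenvalue 1 - |S| n / (d (n - 1)), and n^(-d) times the sum of all E_S is the identity, so
   P^t(x,y) = n^(-d) * sum over S of lambda_|S|^t E_S(x,y). By Cauchy-Schwarz,
   4 TV^2 <= sum over nonempty S of lambda_|S|^(2t) (n-1)^|S|. The nonnegative eigenvalues contribute
   at most exp(d (n-1) exp(-2tn/(d(n-1)))) - 1; since n >= 3 the negative ones are at least -1/2, so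
   they contribute at most n^d / 4^t, which vanishes because t is of order d log d.

   For the lower bound let f be the number of coordinates agreeing with the start, minus d/n. It is an
   eigenfunction, and since it changes by at most 1 per step, its variance at all times and its second
   moment in equilibrium are O(d). Before the cutoff its mean exceeds a large multiple of sqrt d, which
   separates the two distributions by Chebyshev's inequality. *)

theory Submission
  imports Defs "HOL-Analysis.Analysis" "HOL-Real_Asymp.Real_Asymp"
begin

section \<open>States, neighbours and one step of the walk\<close>

lemma finite_rook_states [simp]: "finite (rook_states d n)"
  by (simp add: rook_states_def finite_PiE)

lemma card_rook_states: "card (rook_states d n) = n ^ d"
  by (simp add: rook_states_def card_PiE)

lemma hamming_dist_commute: "hamming_dist d x y = hamming_dist d y x"
  unfolding hamming_dist_def by (rule arg_cong[where f = card]) auto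

lemma rook_trans_commute: "rook_trans d n x y = rook_trans d n y x"
  unfolding rook_trans_def by (subst hamming_dist_commute) (rule refl)

text \<open>Parametrising neighbours by the changed coordinate and its new value turns a sum over a
  row of the transition matrix into a double sum over these two data.\<close>

lemma rook_neighbours:
  assumes y: "y \<in> rook_states d n"
  shows "bij_betw (\<lambda>(i, v). y(i := v)) (SIGMA i:{1..d}. {1..n} - {y i})
           {z \<in> rook_states d n. hamming_dist d y z = 1}"
proof (rule bij_betwI')
  fix p q
  assume pq: "p \<in> (SIGMA i:{1..d}. {1..n} - {y i})" "q \<in> (SIGMA i:{1..d}. {1..n} - {y i})"
  obtain i v j w where [simp]: "p = (i, v)" "q = (j, w)" by (cases p, cases q)
  \<comment> \<open>The new value differs from the old one, so the changed position can be read off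
    from the updated function.\<close>
  have "i = j \<and> v = w" if eq: "y(i := v) = y(j := w)"
  proof -
    have "v \<noteq> y i" using pq by simp
    then have "i = j" using fun_cong[OF eq, of i] by (cases "i = j") simp_all
    then show ?thesis using fun_cong[OF eq, of i] by simp
  qed
  then show "((\<lambda>(i, v). y(i := v)) p = (\<lambda>(i, v). y(i := v)) q) = (p = q)"
    unfolding \<open>p = (i, v)\<close> \<open>q = (j, w)\<close> prod.case prod.inject by blast
next
  fix p
  assume p: "p \<in> (SIGMA i:{1..d}. {1..n} - {y i})"
  obtain i v where [simp]: "p = (i, v)" by (cases p)
  have "{k \<in> {1..d}. y k \<noteq> (y(i := v)) k} = {i}"
  proof (rule set_eqI)
    show "k \<in> {k \<in> {1..d}. y k \<noteq> (y(i := v)) k} \<longleftrightarrow> k \<in> {i}" for k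
      using p by (cases "k = i") simp_all
  qed
  moreover have "y(i := v) \<in> rook_states d n"
  proof -
    have "y(i := v) \<in> insert i {1..d} \<rightarrow>\<^sub>E {1..n}"
      using p y unfolding rook_states_def by (intro PiE_fun_upd) simp_all
    then show ?thesis using p by (simp add: rook_states_def insert_absorb)
  qed
  ultimately show "(\<lambda>(i, v). y(i := v)) p \<in> {z \<in> rook_states d n. hamming_dist d y z = 1}"
    by (simp add: hamming_dist_def)
next
  fix z
  assume z: "z \<in> {z \<in> rook_states d n. hamming_dist d y z = 1}"
  then have "card {k \<in> {1..d}. y k \<noteq> z k} = 1" and zin: "z \<in> rook_states d n"
    by (simp_all add: hamming_dist_def)
  then obtain i where "{k \<in> {1..d}. y k \<noteq> z k} = {i}"
    by (elim card_1_singletonE)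
  then have diff: "k \<in> {1..d} \<and> y k \<noteq> z k \<longleftrightarrow> k = i" for k
    by (simp add: set_eq_iff)
  have i': "i \<in> {1..d}" "y i \<noteq> z i" using diff[of i] by simp_all
  have "z k = (y(i := z i)) k" for k
  proof (cases "k \<in> {1..d}")
    case True
    show ?thesis
    proof (cases "k = i")
      case False
      then have "z k = y k" using True diff[of k] by metis
      then show ?thesis using False by simp
    qed simp
  next
    case False
    then have "k \<noteq> i" using i'(1) by blast
    \<comment> \<open>Elements of \<open>PiE\<close> share a default value outside
      \<open>{1..d}\<close>, so the functions agree there too.\<close>
    moreover have "y k = undefined" "z k = undefined"
      using PiE_arb[OF y[unfolded rook_states_def] False]
        PiE_arb[OF zin[unfolded rook_states_def] False] by simp_all
    ultimately show ?thesis by simp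
  qed
  then have "z = (\<lambda>(i, v). y(i := v)) (i, z i)" unfolding prod.case by (rule ext)
  moreover have "(i, z i) \<in> (SIGMA i:{1..d}. {1..n} - {y i})"
    using i' PiE_mem[OF zin[unfolded rook_states_def] i'(1)] by simp
  ultimately show "\<exists>p\<in>(SIGMA i:{1..d}. {1..n} - {y i}). z = (\<lambda>(i, v). y(i := v)) p"
    by (rule bexI)
qed

lemma sum_rook_trans:
  assumes y: "y \<in> rook_states d n"
  shows "(\<Sum>z\<in>rook_states d n. rook_trans d n y z * g z) =
    (\<Sum>i=1..d. \<Sum>v\<in>{1..n} - {y i}. g (y(i := v))) / (real d * (real n - 1))"
proof -
  have "(\<Sum>z\<in>rook_states d n. rook_trans d n y z * g z)
      = (\<Sum>z\<in>{z \<in> rook_states d n. hamming_dist d y z = 1}. g z / (real d * (real n - 1)))"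
    by (rule sum.mono_neutral_cong_right) (auto simp: rook_trans_def)
  also have "\<dots> = (\<Sum>p\<in>(SIGMA i:{1..d}. {1..n} - {y i}).
      g ((\<lambda>(i, v). y(i := v)) p) / (real d * (real n - 1)))"
    by (rule sum.reindex_bij_betw[OF rook_neighbours[OF y], symmetric])
  also have "\<dots> = (\<Sum>i=1..d. \<Sum>v\<in>{1..n} - {y i}. g (y(i := v)) / (real d * (real n - 1)))"
    by (subst sum.Sigma) (auto intro!: sum.cong)
  also have "\<dots> = (\<Sum>i=1..d. \<Sum>v\<in>{1..n} - {y i}. g (y(i := v))) / (real d * (real n - 1))"
    by (simp only: sum_divide_distrib)
  finally show ?thesis .
qed

section \<open>Eigenvalues, projection kernels and the spectral formula\<close>

definition rook_eigenvalue :: "nat \<Rightarrow> nat \<Rightarrow> nat \<Rightarrow> real" where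
  "rook_eigenvalue d n j = 1 - real j * real n / (real d * (real n - 1))"

text \<open>Up to the factor \<open>n ^ d\<close>, this is the kernel of the orthogonal projection onto the
  functions that depend exactly on the coordinates in \<open>S\<close>.\<close>

definition proj_kernel :: "nat \<Rightarrow> nat set \<Rightarrow> (nat \<Rightarrow> nat) \<Rightarrow> (nat \<Rightarrow> nat) \<Rightarrow> real" where
  "proj_kernel n S x y = (\<Prod>i\<in>S. real n * of_bool (x i = y i) - 1)"

lemma proj_kernel_commute: "proj_kernel n S x y = proj_kernel n S y x"
  unfolding proj_kernel_def by (rule prod.cong) auto

lemma proj_kernel_refl: "proj_kernel n S x x = (real n - 1) ^ card S"
  by (simp add: proj_kernel_def)

lemma sum_Pow_power:
  fixes q :: real
  assumes "finite A"
  shows "(\<Sum>S\<in>Pow A. q ^ card S) = (1 + q) ^ card A"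
  using prod_add[OF assms, of "\<lambda>_. q" "\<lambda>_. 1"] by (simp add: add.commute)

text \<open>Resolution of the identity: writing each factor \<open>n * of_bool (x i = y i)\<close>
  as \<open>(n * of_bool (x i = y i) - 1) + 1\<close> and expanding the product over all coordinates
  gives one term per subset.\<close>

lemma sum_proj_kernel:
  assumes "x \<in> rook_states d n" "y \<in> rook_states d n"
  shows "(\<Sum>S\<in>Pow {1..d}. proj_kernel n S x y) = real n ^ d * of_bool (x = y)"
proof -
  have "(\<Sum>S\<in>Pow {1..d}. proj_kernel n S x y)
      = (\<Prod>i=1..d. (real n * of_bool (x i = y i) - 1) + 1)"
    by (subst prod_add) (simp_all add: proj_kernel_def)
  also have "\<dots> = (\<Prod>i=1..d. real n * of_bool (x i = y i))"
    by simp
  also have "\<dots> = real n ^ d * of_bool (x = y)"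
  proof (cases "x = y")
    case True
    then show ?thesis by simp
  next
    case False
    then obtain i where "i \<in> {1..d}" "x i \<noteq> y i"
      using assms unfolding rook_states_def by (meson PiE_ext)
    then show ?thesis using False by (auto intro!: prod_zero bexI[of _ i])
  qed
  finally show ?thesis .
qed

text \<open>Changing a coordinate outside \<open>S\<close> leaves the kernel alone. Over all
  \<open>n\<close> values of a coordinate in \<open>S\<close> the kernel sums to 0, so the
  \<open>n - 1\<close> proper changes together contribute minus its current value.\<close>

lemma rook_trans_proj_kernel:
  assumes n: "n \<ge> 2" and d: "d > 0" and S: "S \<subseteq> {1..d}"
    and x: "x \<in> rook_states d n" and y: "y \<in> rook_states d n"
  shows "(\<Sum>z\<in>rook_states d n. rook_trans d n y z * proj_kernel n S x z)
    = rook_eigenvalue d n (card S) * proj_kernel n S x y"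
proof -
  let ?g = "proj_kernel n S x"
  have finS: "finite S" using S finite_subset by blast
  have inner: "(\<Sum>v\<in>{1..n} - {y i}. ?g (y(i := v)))
      = (real n - 1) * ?g y - of_bool (i \<in> S) * real n * ?g y" if i: "i \<in> {1..d}" for i
  proof -
    have yi: "y i \<in> {1..n}" and xi: "x i \<in> {1..n}"
      using i x y by (auto simp: rook_states_def)
    show ?thesis
    proof (cases "i \<in> S")
      case False
      then have "?g (y(i := v)) = ?g y" for v
        by (auto simp: proj_kernel_def intro!: prod.cong)
      then show ?thesis using False yi n by (simp add: of_nat_diff)
    next
      case True
      define G where "G = (\<Prod>k\<in>S - {i}. real n * of_bool (x k = y k) - 1)"
      have g: "?g (y(i := v)) = (real n * of_bool (x i = v) - 1) * G" for v
        unfolding proj_kernel_def G_def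
        by (subst prod.remove[OF finS True]) (auto intro!: prod.cong)
      \<comment> \<open>The summand is \<open>n - 1\<close> once and \<open>-1\<close> at the other
        \<open>n - 1\<close> values.\<close>
      have "(\<Sum>v\<in>{1..n}. real n * of_bool (x i = v) - 1) = 0"
        using xi by (simp add: sum_subtractf sum_distrib_left[symmetric] sum.remove[of _ "x i"])
      then have "(\<Sum>v\<in>{1..n}. ?g (y(i := v))) = 0"
        unfolding g by (simp add: sum_distrib_right[symmetric])
      then have "(\<Sum>v\<in>{1..n} - {y i}. ?g (y(i := v))) = - ?g y"
        using yi by (simp add: sum_diff1)
      then show ?thesis using True by (simp add: algebra_simps)
    qed
  qed
  have "(\<Sum>i=1..d. \<Sum>v\<in>{1..n} - {y i}. ?g (y(i := v)))
      = (\<Sum>i=1..d. (real n - 1) * ?g y - of_bool (i \<in> S) * real n * ?g y)"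
    by (rule sum.cong[OF refl inner])
  also have "\<dots>
      = real d * ((real n - 1) * ?g y) - (\<Sum>i=1..d. of_bool (i \<in> S)) * (real n * ?g y)"
    unfolding sum_subtractf sum_distrib_right mult.assoc by simp
  also have "(\<Sum>i=1..d. of_bool (i \<in> S) :: real) = real (card S)"
    using S by (simp add: Int_absorb1)
  finally show ?thesis
    unfolding sum_rook_trans[OF y] rook_eigenvalue_def
    by (simp only:) (use n d in \<open>simp add: field_simps\<close>)
qed

lemma sum_rook_trans_1:
  assumes n: "n \<ge> 2" and d: "d > 0" and y: "y \<in> rook_states d n"
  shows "(\<Sum>z\<in>rook_states d n. rook_trans d n y z) = 1"
  using rook_trans_proj_kernel[OF n d, of "{}" y y] y
  by (simp add: proj_kernel_def rook_eigenvalue_def)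

lemma rook_trans_nonneg: "n \<ge> 1 \<Longrightarrow> rook_trans d n x y \<ge> 0"
  by (simp add: rook_trans_def)

abbreviation rook_pow :: "nat \<Rightarrow> nat \<Rightarrow> nat \<Rightarrow> (nat \<Rightarrow> nat) \<Rightarrow> (nat \<Rightarrow> nat) \<Rightarrow> real" where
  "rook_pow d n \<equiv> trans_pow (rook_states d n) (rook_trans d n)"

text \<open>Time 0 is the resolution of the identity. In the induction step the symmetry of the
  transition matrix lets it act on the second argument of each kernel, which yields one more
  eigenvalue factor.\<close>

lemma rook_pow_spectral:
  assumes n: "n \<ge> 2" and d: "d > 0"
    and x: "x \<in> rook_states d n" and y: "y \<in> rook_states d n"
  shows "rook_pow d n t x y
    = (\<Sum>S\<in>Pow {1..d}. rook_eigenvalue d n (card S) ^ t * proj_kernel n S x y) / real n ^ d"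
  using y
proof (induction t arbitrary: y)
  case 0
  then show ?case using n x by (simp add: sum_proj_kernel del: One_nat_def)
next
  case (Suc t)
  let ?l = "\<lambda>S. rook_eigenvalue d n (card S)"
  have "rook_pow d n (Suc t) x y = (\<Sum>z\<in>rook_states d n.
      (\<Sum>S\<in>Pow {1..d}. ?l S ^ t * proj_kernel n S x z) / real n ^ d * rook_trans d n y z)"
    unfolding trans_pow.simps
    by (intro sum.cong refl arg_cong2[where f = "(*)"] Suc.IH rook_trans_commute)
  also have "\<dots> = (\<Sum>z\<in>rook_states d n. \<Sum>S\<in>Pow {1..d}.
      ?l S ^ t / real n ^ d * (rook_trans d n y z * proj_kernel n S x z))"
    by (intro sum.cong refl)
      (simp add: sum_distrib_left sum_divide_distrib mult_ac)
  also have "\<dots> = (\<Sum>S\<in>Pow {1..d}. ?l S ^ t / real n ^ d *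
      (\<Sum>z\<in>rook_states d n. rook_trans d n y z * proj_kernel n S x z))"
    by (subst sum.swap) (simp only: sum_distrib_left)
  also have "\<dots> = (\<Sum>S\<in>Pow {1..d}. ?l S ^ t / real n ^ d * (?l S * proj_kernel n S x y))"
    by (intro sum.cong refl arg_cong2[where f = "(*)"] rook_trans_proj_kernel)
      (use n d x Suc.prems in auto)
  also have "\<dots> = (\<Sum>S\<in>Pow {1..d}. ?l S ^ Suc t * proj_kernel n S x y) / real n ^ d"
    by (simp add: sum_divide_distrib mult_ac)
  finally show ?case .
qed

section \<open>Powers of transition matrices\<close>

lemma trans_pow_add:
  assumes "finite \<Omega>" "y \<in> \<Omega>"
  shows "trans_pow \<Omega> P (s + t) x y = (\<Sum>z\<in>\<Omega>. trans_pow \<Omega> P s x z * trans_pow \<Omega> P t z y)"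
  using assms(2)
proof (induction t arbitrary: y)
  case 0
  have "(\<Sum>z\<in>\<Omega>. trans_pow \<Omega> P s x z * (if z = y then 1 else 0))
      = (\<Sum>z\<in>\<Omega>. if z = y then trans_pow \<Omega> P s x z else 0)"
    by (intro sum.cong) auto
  then show ?case using 0 assms(1) by simp
next
  case (Suc t)
  have "trans_pow \<Omega> P (s + Suc t) x y
      = (\<Sum>w\<in>\<Omega>. \<Sum>z\<in>\<Omega>. trans_pow \<Omega> P s x z * (trans_pow \<Omega> P t z w * P w y))"
    by (simp add: Suc.IH sum_distrib_right mult.assoc)
  also have "\<dots> = (\<Sum>z\<in>\<Omega>. \<Sum>w\<in>\<Omega>. trans_pow \<Omega> P s x z * (trans_pow \<Omega> P t z w * P w y))"
    by (rule sum.swap)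
  finally show ?case by (simp add: sum_distrib_left)
qed

lemma trans_pow_nonneg:
  assumes "\<And>x y. P x y \<ge> 0"
  shows "trans_pow \<Omega> P t x y \<ge> 0"
  by (induction t arbitrary: y) (auto intro!: sum_nonneg mult_nonneg_nonneg assms)

lemma sum_trans_pow_Suc_mult:
  "(\<Sum>y\<in>\<Omega>. trans_pow \<Omega> P (Suc t) x y * g y)
    = (\<Sum>z\<in>\<Omega>. trans_pow \<Omega> P t x z * (\<Sum>y\<in>\<Omega>. P z y * g y))"
proof -
  have "(\<Sum>y\<in>\<Omega>. trans_pow \<Omega> P (Suc t) x y * g y)
      = (\<Sum>y\<in>\<Omega>. \<Sum>z\<in>\<Omega>. trans_pow \<Omega> P t x z * (P z y * g y))"
    by (simp add: sum_distrib_right mult.assoc)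
  also have "\<dots> = (\<Sum>z\<in>\<Omega>. \<Sum>y\<in>\<Omega>. trans_pow \<Omega> P t x z * (P z y * g y))"
    by (rule sum.swap)
  finally show ?thesis by (simp add: sum_distrib_left)
qed

lemma sum_trans_pow_0_mult:
  assumes "finite \<Omega>" "x \<in> \<Omega>"
  shows "(\<Sum>y\<in>\<Omega>. trans_pow \<Omega> P 0 x y * g y) = g x"
proof -
  have "(\<Sum>y\<in>\<Omega>. trans_pow \<Omega> P 0 x y * g y) = (\<Sum>y\<in>\<Omega>. if x = y then g y else 0)"
    by (intro sum.cong) auto
  then show ?thesis using assms by simp
qed

lemma sum_rook_pow:
  assumes n: "n \<ge> 2" and d: "d > 0" and x: "x \<in> rook_states d n"
  shows "(\<Sum>y\<in>rook_states d n. rook_pow d n t x y) = 1"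
proof (induction t)
  case 0
  then show ?case using sum_trans_pow_0_mult[OF finite_rook_states x, of _ "\<lambda>_. 1"] by simp
next
  case (Suc t)
  have "(\<Sum>y\<in>rook_states d n. rook_pow d n (Suc t) x y)
      = (\<Sum>z\<in>rook_states d n. rook_pow d n t x z * (\<Sum>y\<in>rook_states d n. rook_trans d n z y))"
    using sum_trans_pow_Suc_mult[of "rook_states d n" "rook_trans d n" t x "\<lambda>_. 1"] by simp
  also have "\<dots> = (\<Sum>z\<in>rook_states d n. rook_pow d n t x z)"
    using sum_rook_trans_1[OF n d] by (intro sum.cong) auto
  finally show ?case using Suc by simp
qed

subsection \<open>Upper bound\<close>

text \<open>The L2 bound: Cauchy-Schwarz reduces the claim to the sum of squares of a row, which for
  a symmetric chain is the return probability after \<open>2 * t\<close> steps, and the spectral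
  formula evaluates it.\<close>

lemma rook_tv_spectral_bound:
  assumes n: "n \<ge> 2" and d: "d > 0" and x: "x \<in> rook_states d n"
  shows "(2 * tv_dist (rook_states d n) (rook_pow d n t x) (rook_stat d n))\<^sup>2
    \<le> (\<Sum>S\<in>Pow {1..d} - {{}}. rook_eigenvalue d n (card S) ^ (2 * t) * (real n - 1) ^ card S)"
proof -
  let ?\<Omega> = "rook_states d n" and ?p = "rook_pow d n t x" and ?N = "real n ^ d"
  have N: "?N > 0" using n by simp
  have st: "rook_stat d n y = 1 / ?N" for y by (simp add: rook_stat_def card_rook_states)
  have sym: "rook_pow d n t z x = rook_pow d n t x z" if "z \<in> ?\<Omega>" for z
    using n d x that by (simp add: rook_pow_spectral proj_kernel_commute)
  have "(2 * tv_dist ?\<Omega> ?p (rook_stat d n))\<^sup>2 = (\<Sum>y\<in>?\<Omega>. \<bar>?p y - 1 / ?N\<bar> * 1)\<^sup>2"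
    by (simp add: tv_dist_def st)
  also have "\<dots> \<le> (\<Sum>y\<in>?\<Omega>. \<bar>?p y - 1 / ?N\<bar>\<^sup>2) * (\<Sum>y\<in>?\<Omega>. 1\<^sup>2)"
    by (rule Cauchy_Schwarz_ineq_sum)
  also have "\<dots> = (\<Sum>y\<in>?\<Omega>. (?p y)\<^sup>2 - 2 / ?N * ?p y + 1 / ?N\<^sup>2) * ?N"
    by (simp add: card_rook_states power2_diff power_divide mult_ac diff_add_eq)
  also have "\<dots> = ((\<Sum>y\<in>?\<Omega>. (?p y)\<^sup>2) - 2 / ?N * (\<Sum>y\<in>?\<Omega>. ?p y) + ?N * (1 / ?N\<^sup>2)) * ?N"
    by (simp add: sum.distrib sum_subtractf sum_distrib_left card_rook_states)
  also have "\<dots> = ?N * (\<Sum>y\<in>?\<Omega>. (?p y)\<^sup>2) - 1"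
    using N by (simp add: sum_rook_pow[OF n d x] power2_eq_square algebra_simps)
  also have "(\<Sum>y\<in>?\<Omega>. (?p y)\<^sup>2) = rook_pow d n (t + t) x x"
    by (simp add: trans_pow_add[OF finite_rook_states x] sym power2_eq_square)
  also have "?N * rook_pow d n (t + t) x x
      = (\<Sum>S\<in>Pow {1..d}. rook_eigenvalue d n (card S) ^ (2 * t) * (real n - 1) ^ card S)"
    using N by (simp add: rook_pow_spectral[OF n d x x] proj_kernel_refl mult_2)
  \<comment> \<open>The subtracted 1 is the term of the empty set, whose eigenvalue is 1.\<close>
  also have "\<dots> - 1 = (\<Sum>S\<in>Pow {1..d} - {{}}.
      rook_eigenvalue d n (card S) ^ (2 * t) * (real n - 1) ^ card S)"
    by (subst sum_diff1) (auto simp: rook_eigenvalue_def)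
  finally show ?thesis .
qed

text \<open>A nonnegative eigenvalue is bounded through \<open>1 - x \<le> exp (- x)\<close>. A
  negative one has absolute value at most 1/2, because \<open>n / (n - 1) \<le> 3 / 2\<close> once
  \<open>n \<ge> 3\<close>. Adding both bounds avoids splitting the later sum by sign.\<close>

lemma rook_eigenvalue_power_le:
  assumes n: "n \<ge> 3" and d: "d > 0" and j: "j \<le> d"
  shows "rook_eigenvalue d n j ^ (2 * t)
    \<le> exp (- 2 * real t * real n / (real d * (real n - 1))) ^ j + (1 / 4) ^ t"
proof -
  let ?l = "rook_eigenvalue d n j"
  have "real j * real n / (real d * (real n - 1)) \<le> real d * real n / (real d * (real n - 1))"
    using n j by (intro divide_right_mono mult_right_mono) auto
  also have "\<dots> \<le> 3 / 2" using n d by (simp add: field_simps)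
  finally have lower: "?l \<ge> - 1 / 2" by (simp add: rook_eigenvalue_def)
  show ?thesis
  proof (cases "?l \<ge> 0")
    case True
    have "?l \<le> exp (- (real j * real n / (real d * (real n - 1))))"
      using exp_ge_add_one_self[of "- (real j * real n / (real d * (real n - 1)))"]
      by (simp add: rook_eigenvalue_def)
    then have "?l ^ (2 * t) \<le> exp (- (real j * real n / (real d * (real n - 1)))) ^ (2 * t)"
      using True by (intro power_mono) auto
    also have "\<dots> = exp (- 2 * real t * real n / (real d * (real n - 1))) ^ j"
      by (simp add: exp_of_nat_mult[symmetric] mult_ac)
    finally show ?thesis by (smt (verit) zero_le_power zero_le_divide_1_iff)
  next
    case False
    then have "?l\<^sup>2 \<le> (1 / 2)\<^sup>2" using lower by (intro power2_le_iff_abs_le[THEN iffD2]) auto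
    then have "(?l\<^sup>2) ^ t \<le> (1 / 4) ^ t" by (intro power_mono) (auto simp: power2_eq_square)
    then show ?thesis by (simp add: power_mult add_increasing)
  qed
qed

text \<open>The binomial theorem sums both parts of the eigenvalue bound over all \<open>S\<close>;
  the exponential part becomes \<open>(1 + q) ^ d \<le> exp (d * q)\<close>.\<close>

lemma rook_tv_upper:
  assumes n: "n \<ge> 3" and d: "d > 0" and x: "x \<in> rook_states d n"
  shows "(2 * tv_dist (rook_states d n) (rook_pow d n t x) (rook_stat d n))\<^sup>2
    \<le> exp (real d * (real n - 1) * exp (- 2 * real t * real n / (real d * (real n - 1)))) - 1
      + real n ^ d / 4 ^ t"
proof -
  let ?e = "exp (- 2 * real t * real n / (real d * (real n - 1)))"
  have "(2 * tv_dist (rook_states d n) (rook_pow d n t x) (rook_stat d n))\<^sup>2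
      \<le> (\<Sum>S\<in>Pow {1..d} - {{}}. rook_eigenvalue d n (card S) ^ (2 * t) * (real n - 1) ^ card S)"
    using n d x by (intro rook_tv_spectral_bound) auto
  also have "\<dots> \<le> (\<Sum>S\<in>Pow {1..d} - {{}}. (?e ^ card S + (1 / 4) ^ t) * (real n - 1) ^ card S)"
  proof (intro sum_mono mult_right_mono rook_eigenvalue_power_le n d)
    fix S assume "S \<in> Pow {1..d} - {{}}"
    then show "card S \<le> d" using card_mono[of "{1..d}" S] by auto
  qed (use n in auto)
  \<comment> \<open>The empty set contributes \<open>1 + (1 / 4) ^ t\<close>; the 1 is kept, and
    \<open>- (1 / 4) ^ t\<close> is dropped at the end.\<close>
  also have "\<dots> = (\<Sum>S\<in>Pow {1..d}. (?e ^ card S + (1 / 4) ^ t) * (real n - 1) ^ card S)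
      - 1 - (1 / 4) ^ t"
    by (subst sum_diff1) auto
  also have "(\<Sum>S\<in>Pow {1..d}. (?e ^ card S + (1 / 4) ^ t) * (real n - 1) ^ card S)
      = (\<Sum>S\<in>Pow {1..d}. (?e * (real n - 1)) ^ card S)
        + (1 / 4) ^ t * (\<Sum>S\<in>Pow {1..d}. (real n - 1) ^ card S)"
    by (simp add: sum.distrib sum_distrib_left distrib_right power_mult_distrib)
  also have "\<dots> = (1 + ?e * (real n - 1)) ^ d + real n ^ d / 4 ^ t"
    by (subst (1 2) sum_Pow_power) (auto simp: power_divide)
  also have "(1 + ?e * (real n - 1)) ^ d \<le> exp (?e * (real n - 1)) ^ d"
    using n by (intro power_mono) (auto intro: exp_ge_add_one_self)
  also have "\<dots> = exp (real d * (real n - 1) * ?e)"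
    by (simp add: exp_of_nat_mult[symmetric] mult_ac)
  finally show ?thesis by (smt (verit) zero_le_power zero_le_divide_1_iff)
qed

subsection \<open>Lower bound\<close>

text \<open>Chebyshev's inequality pointwise, with threshold \<open>m / 2\<close>: where
  \<open>f\<close> is below it, \<open>f\<close> is far from \<open>m\<close> and the \<mu>-term
  dominates; above it, \<open>f\<close> is far from 0 and the \<nu>-term does.\<close>

lemma tv_dist_second_moment:
  assumes fin: "finite \<Omega>" and \<mu>: "\<And>x. x \<in> \<Omega> \<Longrightarrow> \<mu> x \<ge> 0" "sum \<mu> \<Omega> = 1"
    and \<nu>: "\<And>x. x \<in> \<Omega> \<Longrightarrow> \<nu> x \<ge> 0" "sum \<nu> \<Omega> = 1" and m: "m > 0"
  shows "1 - tv_dist \<Omega> \<mu> \<nu>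
    \<le> 4 / m\<^sup>2 * ((\<Sum>x\<in>\<Omega>. \<mu> x * (f x - m)\<^sup>2) + (\<Sum>x\<in>\<Omega>. \<nu> x * (f x)\<^sup>2))"
proof -
  \<comment> \<open>The summand is the minimum of \<open>\<mu> x\<close> and \<open>\<nu> x\<close>,
    so either of the two bounds it.\<close>
  have "1 - tv_dist \<Omega> \<mu> \<nu> = (\<Sum>x\<in>\<Omega>. (\<mu> x + \<nu> x - \<bar>\<mu> x - \<nu> x\<bar>) / 2)"
    by (simp add: tv_dist_def \<mu>(2) \<nu>(2) sum.distrib sum_subtractf sum_divide_distrib[symmetric]
        diff_divide_distrib)
  also have "\<dots> \<le> (\<Sum>x\<in>\<Omega>. 4 / m\<^sup>2 * (\<mu> x * (f x - m)\<^sup>2 + \<nu> x * (f x)\<^sup>2))"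
  proof (rule sum_mono)
    fix x assume x: "x \<in> \<Omega>"
    show "(\<mu> x + \<nu> x - \<bar>\<mu> x - \<nu> x\<bar>) / 2 \<le> 4 / m\<^sup>2 * (\<mu> x * (f x - m)\<^sup>2 + \<nu> x * (f x)\<^sup>2)"
    proof (cases "f x \<le> m / 2")
      case True
      then have "(m / 2)\<^sup>2 \<le> (m - f x)\<^sup>2" using m by (intro power_mono) auto
      then have "1 \<le> 4 / m\<^sup>2 * (f x - m)\<^sup>2" using m by (simp add: field_simps power2_commute)
      from mult_left_mono[OF this \<mu>(1)[OF x]]
      have "\<mu> x \<le> 4 / m\<^sup>2 * (\<mu> x * (f x - m)\<^sup>2)" by (simp add: mult_ac)
      moreover have "0 \<le> 4 / m\<^sup>2 * (\<nu> x * (f x)\<^sup>2)" using \<nu>(1)[OF x] by simp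
      ultimately show ?thesis by (simp add: distrib_left abs_if)
    next
      case False
      then have "(m / 2)\<^sup>2 \<le> (f x)\<^sup>2" using m by (intro power_mono) auto
      then have "1 \<le> 4 / m\<^sup>2 * (f x)\<^sup>2" using m by (simp add: field_simps)
      from mult_left_mono[OF this \<nu>(1)[OF x]]
      have "\<nu> x \<le> 4 / m\<^sup>2 * (\<nu> x * (f x)\<^sup>2)" by (simp add: mult_ac)
      moreover have "0 \<le> 4 / m\<^sup>2 * (\<mu> x * (f x - m)\<^sup>2)" using \<mu>(1)[OF x] by simp
      ultimately show ?thesis by (simp add: distrib_left abs_if)
    qed
  qed
  also have "\<dots> = 4 / m\<^sup>2 * ((\<Sum>x\<in>\<Omega>. \<mu> x * (f x - m)\<^sup>2) + (\<Sum>x\<in>\<Omega>. \<nu> x * (f x)\<^sup>2))"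
    by (simp only: sum.distrib sum_distrib_left[symmetric])
  finally show ?thesis .
qed

definition rook_overlap :: "nat \<Rightarrow> nat \<Rightarrow> (nat \<Rightarrow> nat) \<Rightarrow> (nat \<Rightarrow> nat) \<Rightarrow> real" where
  "rook_overlap d n x z = (\<Sum>i=1..d. of_bool (x i = z i) - 1 / real n)"

lemma rook_overlap_refl: "rook_overlap d n x x = real d * (1 - 1 / real n)"
  by (simp add: rook_overlap_def)

lemma rook_overlap_proj_kernel:
  assumes "n > 0"
  shows "rook_overlap d n x z = (\<Sum>i=1..d. proj_kernel n {i} x z) / real n"
  using assms by (simp add: rook_overlap_def proj_kernel_def sum_divide_distrib diff_divide_distrib)

text \<open>The overlap is a multiple of the sum of the singleton kernels, which all share one
  eigenvalue.\<close>

lemma rook_trans_overlap: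
  assumes n: "n \<ge> 2" and d: "d > 0" and x: "x \<in> rook_states d n" and y: "y \<in> rook_states d n"
  shows "(\<Sum>z\<in>rook_states d n. rook_trans d n y z * rook_overlap d n x z)
    = rook_eigenvalue d n 1 * rook_overlap d n x y"
proof -
  have n0: "n > 0" using n by simp
  have "(\<Sum>z\<in>rook_states d n. rook_trans d n y z * rook_overlap d n x z)
      = (\<Sum>z\<in>rook_states d n. \<Sum>i=1..d. rook_trans d n y z * proj_kernel n {i} x z) / real n"
    by (simp add: rook_overlap_proj_kernel[OF n0] sum_distrib_left sum_divide_distrib)
  also have "\<dots> = (\<Sum>i=1..d. \<Sum>z\<in>rook_states d n. rook_trans d n y z * proj_kernel n {i} x z)
      / real n"
    by (subst sum.swap) (rule refl)
  also have "\<dots> = (\<Sum>i=1..d. rook_eigenvalue d n (card {i}) * proj_kernel n {i} x y) / real n"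
    by (intro arg_cong2[where f = "(/)"] sum.cong refl rook_trans_proj_kernel)
      (use n d x y in auto)
  also have "\<dots> = rook_eigenvalue d n 1 * rook_overlap d n x y"
    by (simp add: rook_overlap_proj_kernel[OF n0] sum_distrib_left)
  finally show ?thesis .
qed

text \<open>Only the indicator of the changed coordinate can differ, so the overlap moves by -1, 0
  or 1.\<close>

lemma rook_overlap_neighbour:
  assumes "hamming_dist d y z = 1"
  shows "(rook_overlap d n x z - rook_overlap d n x y)\<^sup>2 \<le> 1"
proof -
  obtain i where i: "{k \<in> {1..d}. y k \<noteq> z k} = {i}"
    using assms unfolding hamming_dist_def by (elim card_1_singletonE)
  have "rook_overlap d n x z - rook_overlap d n x y
      = (\<Sum>k=1..d. of_bool (x k = z k) - of_bool (x k = y k))"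
    by (simp add: rook_overlap_def sum_subtractf)
  also have "\<dots> = (\<Sum>k\<in>{i}. of_bool (x k = z k) - of_bool (x k = y k))"
  proof (rule sum.mono_neutral_right)
    show "{i} \<subseteq> {1..d}" using i by blast
    have "y k = z k" if "k \<in> {1..d} - {i}" for k
      using i that by blast
    then show "\<forall>k\<in>{1..d} - {i}. of_bool (x k = z k) - of_bool (x k = y k) = (0::real)"
      by simp
  qed simp
  finally show ?thesis by auto
qed

text \<open>Expand the square of the overlap around its value at \<open>y\<close>: the linear term is governed
  by the eigenvalue, and the quadratic one is at most 1 because a step moves only one coordinate.\<close>

lemma rook_trans_overlap_square:
  assumes n: "n \<ge> 2" and d: "d > 0" and x: "x \<in> rook_states d n" and y: "y \<in> rook_states d n"
  shows "(\<Sum>z\<in>rook_states d n. rook_trans d n y z * (rook_overlap d n x z)\<^sup>2)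
    \<le> (2 * rook_eigenvalue d n 1 - 1) * (rook_overlap d n x y)\<^sup>2 + 1"
proof -
  let ?\<Omega> = "rook_states d n" and ?P = "rook_trans d n y" and ?f = "rook_overlap d n x"
  have "(\<Sum>z\<in>?\<Omega>. ?P z * (?f z)\<^sup>2)
      = (\<Sum>z\<in>?\<Omega>. 2 * ?f y * (?P z * ?f z) - (?f y)\<^sup>2 * ?P z + ?P z * (?f z - ?f y)\<^sup>2)"
    by (intro sum.cong refl) (simp add: power2_eq_square algebra_simps)
  also have "\<dots> = 2 * ?f y * (\<Sum>z\<in>?\<Omega>. ?P z * ?f z) - (?f y)\<^sup>2 * (\<Sum>z\<in>?\<Omega>. ?P z)
      + (\<Sum>z\<in>?\<Omega>. ?P z * (?f z - ?f y)\<^sup>2)"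
    by (simp only: sum.distrib sum_subtractf sum_distrib_left)
  also have "(\<Sum>z\<in>?\<Omega>. ?P z * (?f z - ?f y)\<^sup>2) \<le> (\<Sum>z\<in>?\<Omega>. ?P z)"
  proof (rule sum_mono)
    fix z
    show "?P z * (?f z - ?f y)\<^sup>2 \<le> ?P z"
    proof (cases "hamming_dist d y z = 1")
      case True
      show ?thesis
        using mult_left_mono[OF rook_overlap_neighbour[OF True] rook_trans_nonneg] n by simp
    qed (simp add: rook_trans_def)
  qed
  finally show ?thesis
    using sum_rook_trans_1[OF n d y] rook_trans_overlap[OF n d x y]
    by (simp add: power2_eq_square algebra_simps)
qed

lemma rook_pow_overlap:
  assumes n: "n \<ge> 2" and d: "d > 0" and x: "x \<in> rook_states d n"
  shows "(\<Sum>y\<in>rook_states d n. rook_pow d n t x y * rook_overlap d n x y)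
    = real d * (1 - 1 / real n) * rook_eigenvalue d n 1 ^ t"
proof (induction t)
  case 0
  show ?case
    using sum_trans_pow_0_mult[OF finite_rook_states x] by (simp add: rook_overlap_refl)
next
  case (Suc t)
  have "(\<Sum>y\<in>rook_states d n. rook_pow d n (Suc t) x y * rook_overlap d n x y)
      = (\<Sum>z\<in>rook_states d n. rook_eigenvalue d n 1 * (rook_pow d n t x z * rook_overlap d n x z))"
    unfolding sum_trans_pow_Suc_mult
    by (intro sum.cong refl) (simp add: rook_trans_overlap[OF n d x])
  also have "\<dots> = rook_eigenvalue d n 1 * (real d * (1 - 1 / real n) * rook_eigenvalue d n 1 ^ t)"
    by (simp only: sum_distrib_left[symmetric] Suc.IH)
  finally show ?case by simp
qed

text \<open>With \<lambda> the eigenvalue, the second moment satisfies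
  \<open>M (t + 1) \<le> (2 * \<lambda> - 1) * M t + 1\<close>. As the first summand of the bound is
  the squared mean, the variance stays below the second one at all times.\<close>

lemma rook_pow_overlap_square:
  assumes n: "n \<ge> 2" and d: "d > 0" and x: "x \<in> rook_states d n"
    and half: "rook_eigenvalue d n 1 \<ge> 1 / 2"
  shows "(\<Sum>y\<in>rook_states d n. rook_pow d n t x y * (rook_overlap d n x y)\<^sup>2)
    \<le> (real d * (1 - 1 / real n) * rook_eigenvalue d n 1 ^ t)\<^sup>2
      + real d * (real n - 1) / (2 * real n)"
proof (induction t)
  case 0
  show ?case
    using n sum_trans_pow_0_mult[OF finite_rook_states x] by (simp add: rook_overlap_refl)
next
  case (Suc t)
  let ?\<Omega> = "rook_states d n" and ?l = "rook_eigenvalue d n 1"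
  let ?m = "real d * (1 - 1 / real n) * ?l ^ t"
  have "(\<Sum>y\<in>?\<Omega>. rook_pow d n (Suc t) x y * (rook_overlap d n x y)\<^sup>2)
      \<le> (\<Sum>z\<in>?\<Omega>. rook_pow d n t x z * ((2 * ?l - 1) * (rook_overlap d n x z)\<^sup>2 + 1))"
    unfolding sum_trans_pow_Suc_mult using n
    by (intro sum_mono mult_left_mono rook_trans_overlap_square trans_pow_nonneg
        rook_trans_nonneg n d x) auto
  also have "\<dots> = (\<Sum>z\<in>?\<Omega>. (2 * ?l - 1) * (rook_pow d n t x z * (rook_overlap d n x z)\<^sup>2)
      + rook_pow d n t x z)"
    by (intro sum.cong refl) (simp add: algebra_simps)
  also have "\<dots> = (2 * ?l - 1) * (\<Sum>z\<in>?\<Omega>. rook_pow d n t x z * (rook_overlap d n x z)\<^sup>2) + 1"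
    by (simp only: sum.distrib sum_distrib_left sum_rook_pow[OF n d x])
  \<comment> \<open>The hypothesis \<open>half\<close> makes the factor nonnegative, so the
    induction hypothesis may be inserted.\<close>
  also have "\<dots> \<le> (2 * ?l - 1) * (?m\<^sup>2 + real d * (real n - 1) / (2 * real n)) + 1"
    using half Suc by (intro add_right_mono mult_left_mono) auto
  \<comment> \<open>The additive constant is the fixed point \<open>1 / (2 * (1 - ?l))\<close> of
    the recursion, hence reproduced exactly.\<close>
  also have "\<dots> = (2 * ?l - 1) * ?m\<^sup>2 + real d * (real n - 1) / (2 * real n)"
    using n d by (simp add: rook_eigenvalue_def field_simps)
  finally have rec: "(\<Sum>y\<in>?\<Omega>. rook_pow d n (Suc t) x y * (rook_overlap d n x y)\<^sup>2)
      \<le> (2 * ?l - 1) * ?m\<^sup>2 + real d * (real n - 1) / (2 * real n)" .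
  have "2 * ?l - 1 \<le> ?l\<^sup>2"
    using zero_le_power2[of "?l - 1"] by (simp add: power2_eq_square algebra_simps)
  then have "(2 * ?l - 1) * ?m\<^sup>2 \<le> ?l\<^sup>2 * ?m\<^sup>2"
    by (rule mult_right_mono) simp
  also have "?l\<^sup>2 * ?m\<^sup>2 = (real d * (1 - 1 / real n) * ?l ^ Suc t)\<^sup>2"
    by (simp add: power_mult_distrib[symmetric] mult_ac)
  finally show ?case using rec by linarith
qed

text \<open>Since the transition matrix is symmetric, one step preserves the uniform distribution.
  The equilibrium second moment thus satisfies the one-step inequality with itself on both sides,
  which is solved for it.\<close>

lemma rook_stat_overlap_square:
  assumes n: "n \<ge> 2" and d: "d > 0" and x: "x \<in> rook_states d n"
  shows "(\<Sum>y\<in>rook_states d n. rook_stat d n y * (rook_overlap d n x y)\<^sup>2)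
    \<le> real d * (real n - 1) / (2 * real n)"
proof -
  let ?\<Omega> = "rook_states d n" and ?N = "real n ^ d" and ?l = "rook_eigenvalue d n 1"
  define V where "V = (\<Sum>y\<in>?\<Omega>. (rook_overlap d n x y)\<^sup>2)"
  have N: "?N > 0" using n by simp
  have "V = (\<Sum>z\<in>?\<Omega>. \<Sum>y\<in>?\<Omega>. rook_trans d n z y * (rook_overlap d n x z)\<^sup>2)"
    unfolding V_def by (intro sum.cong refl)
      (simp add: sum_distrib_right[symmetric] sum_rook_trans_1[OF n d])
  also have "\<dots> = (\<Sum>y\<in>?\<Omega>. \<Sum>z\<in>?\<Omega>. rook_trans d n y z * (rook_overlap d n x z)\<^sup>2)"
    by (subst sum.swap) (simp add: rook_trans_commute)
  also have "\<dots> \<le> (\<Sum>y\<in>?\<Omega>. (2 * ?l - 1) * (rook_overlap d n x y)\<^sup>2 + 1)"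
    by (intro sum_mono rook_trans_overlap_square n d x)
  also have "\<dots> = (2 * ?l - 1) * V + ?N"
    by (simp add: V_def sum.distrib sum_distrib_left card_rook_states)
  finally have "V * (2 * (1 - ?l)) \<le> ?N" by (simp add: algebra_simps)
  then have "V / ?N \<le> real d * (real n - 1) / (2 * real n)"
    using n d N by (simp add: rook_eigenvalue_def field_simps)
  then show ?thesis
    by (simp add: rook_stat_def card_rook_states V_def sum_divide_distrib)
qed

text \<open>With \<open>b = d * (n - 1) / n\<close>, the overlap has mean
  \<open>m = b * \<lambda> ^ t\<close> and variance at most \<open>b / 2\<close> at time
  \<open>t\<close>, and second moment at most \<open>b / 2\<close> in equilibrium. The second moment
  method gives \<open>4 * b / m\<^sup>2\<close>.\<close>

lemma rook_tv_lower:
  assumes n: "n \<ge> 2" and d: "d > 0" and x: "x \<in> rook_states d n"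
    and half: "rook_eigenvalue d n 1 \<ge> 1 / 2"
  shows "1 - tv_dist (rook_states d n) (rook_pow d n t x) (rook_stat d n)
    \<le> 4 * real n / (real d * (real n - 1) * rook_eigenvalue d n 1 ^ (2 * t))"
proof -
  let ?\<Omega> = "rook_states d n" and ?l = "rook_eigenvalue d n 1" and ?p = "rook_pow d n t x"
  let ?f = "rook_overlap d n x"
  define b where "b = real d * (real n - 1) / real n"
  define m where "m = b * ?l ^ t"
  have b: "b > 0" "real d * (1 - 1 / real n) = b" "real d * (real n - 1) / (2 * real n) = b / 2"
    using n d by (auto simp: b_def field_simps)
  have l: "?l > 0" using half by simp
  have m: "m > 0" using b l by (simp add: m_def)
  have mean: "(\<Sum>y\<in>?\<Omega>. ?p y * ?f y) = m"
    using rook_pow_overlap[OF n d x, of t] by (simp add: b m_def)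
  have "(\<Sum>y\<in>?\<Omega>. ?p y * (?f y - m)\<^sup>2)
      = (\<Sum>y\<in>?\<Omega>. ?p y * (?f y)\<^sup>2 - 2 * m * (?p y * ?f y) + m\<^sup>2 * ?p y)"
    by (intro sum.cong refl) (simp add: power2_eq_square algebra_simps)
  also have "\<dots> = (\<Sum>y\<in>?\<Omega>. ?p y * (?f y)\<^sup>2) - 2 * m * m + m\<^sup>2 * 1"
    by (simp only: sum.distrib sum_subtractf sum_distrib_left[symmetric] mean sum_rook_pow[OF n d x])
  also have "\<dots> = (\<Sum>y\<in>?\<Omega>. ?p y * (?f y)\<^sup>2) - m\<^sup>2"
    by (simp add: power2_eq_square)
  also have "\<dots> \<le> b / 2"
    using rook_pow_overlap_square[OF n d x half, of t] by (simp add: b m_def)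
  finally have var: "(\<Sum>y\<in>?\<Omega>. ?p y * (?f y - m)\<^sup>2) \<le> b / 2" .
  have "1 - tv_dist ?\<Omega> ?p (rook_stat d n)
      \<le> 4 / m\<^sup>2 * ((\<Sum>y\<in>?\<Omega>. ?p y * (?f y - m)\<^sup>2) + (\<Sum>y\<in>?\<Omega>. rook_stat d n y * (?f y)\<^sup>2))"
    using n m by (intro tv_dist_second_moment sum_rook_pow[OF n d x])
      (auto intro!: trans_pow_nonneg rook_trans_nonneg simp: rook_stat_def card_rook_states)
  also have "\<dots> \<le> 4 / m\<^sup>2 * (b / 2 + b / 2)"
    using var rook_stat_overlap_square[OF n d x] b by (intro mult_left_mono add_mono) auto
  also have "\<dots> = 4 / (b * ?l ^ (2 * t))"
    using b by (simp add: m_def power_mult_distrib power_even_eq power2_eq_square)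
  also have "\<dots> = 4 * real n / (real d * (real n - 1) * ?l ^ (2 * t))"
    using n by (simp add: b_def)
  finally show ?thesis .
qed

subsection \<open>Mixing time\<close>

lemma rook_states_nonempty: "n \<ge> 1 \<Longrightarrow> rook_states d n \<noteq> {}"
  by (auto simp: rook_states_def PiE_eq_empty_iff)

lemma mixing_time_le:
  assumes "finite \<Omega>" "\<Omega> \<noteq> {}"
    and "\<And>x. x \<in> \<Omega> \<Longrightarrow> tv_dist \<Omega> (trans_pow \<Omega> P t x) \<pi> \<le> \<epsilon>" and "real t \<le> T"
  shows "ereal_of_enat (mixing_time \<Omega> P \<pi> \<epsilon>) \<le> ereal T"
proof -
  have "dist_to_stat \<Omega> P \<pi> t \<le> \<epsilon>"
    using assms by (simp add: dist_to_stat_def)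
  then have "mixing_time \<Omega> P \<pi> \<epsilon> \<le> enat t"
    unfolding mixing_time_def by (intro Inf_lower) auto
  then have "ereal_of_enat (mixing_time \<Omega> P \<pi> \<epsilon>) \<le> ereal_of_enat (enat t)"
    by (simp only: ereal_of_enat_le_iff)
  also have "\<dots> \<le> ereal T" using assms(4) by simp
  finally show ?thesis .
qed

text \<open>One badly mixed starting state suffices, because \<open>dist_to_stat\<close> is a
  maximum over all of them.\<close>

lemma mixing_time_ge:
  assumes "finite \<Omega>" "x \<in> \<Omega>"
    and "\<And>t. real t < T \<Longrightarrow> tv_dist \<Omega> (trans_pow \<Omega> P t x) \<pi> > \<epsilon>"
  shows "ereal T \<le> ereal_of_enat (mixing_time \<Omega> P \<pi> \<epsilon>)"
proof -
  let ?A = "enat ` {t. dist_to_stat \<Omega> P \<pi> t \<le> \<epsilon>}"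
  have ge: "T \<le> real t" if "dist_to_stat \<Omega> P \<pi> t \<le> \<epsilon>" for t
  proof (rule ccontr)
    assume "\<not> T \<le> real t"
    then have "tv_dist \<Omega> (trans_pow \<Omega> P t x) \<pi> > \<epsilon>" using assms(3) by simp
    moreover have "tv_dist \<Omega> (trans_pow \<Omega> P t x) \<pi> \<le> dist_to_stat \<Omega> P \<pi> t"
      using assms(1,2) unfolding dist_to_stat_def by (intro Max_ge) auto
    ultimately show False using that by simp
  qed
  show ?thesis
  proof (cases "?A = {}")
    \<comment> \<open>If the level is never reached, the mixing time is infinite and the bound is
      trivial.\<close>
    case True
    then show ?thesis by (simp add: mixing_time_def top_enat_def)
  next
    case False
    then have "Inf ?A \<in> ?A" by (metis Inf_enat_def LeastI ex_in_conv)
    then show ?thesis using ge by (auto simp: mixing_time_def)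
  qed
qed

text \<open>\<open>c\<close> is calibrated so that the exponential part of the bound is at most
  \<open>2 * \<epsilon>\<^sup>2\<close>. The tail from the negative eigenvalues takes another
  \<open>2 * \<epsilon>\<^sup>2\<close>, and together they give
  \<open>(2 * \<epsilon>)\<^sup>2\<close>. The extra 1 beside \<open>c\<close> pays for rounding the
  time up.\<close>

lemma rook_mixing_time_upper:
  fixes n :: nat and \<epsilon> :: real
  assumes n: "n \<ge> 3" and \<epsilon>: "0 < \<epsilon>" "\<epsilon> < 1"
  defines "c \<equiv> ln ((real n - 1) / ln (1 + 2 * \<epsilon>\<^sup>2)) / 2"
  shows "\<forall>\<^sub>F d in sequentially. ereal_of_enat (rook_mixing_time d n \<epsilon>)
    \<le> ereal (real d * (real n - 1) / (2 * real n) * ln (real d)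
        + (c + 1) * (real d * (real n - 1) / real n))"
proof -
  have "\<epsilon>\<^sup>2 < 1" using \<epsilon> by (simp add: power_less_one_iff)
  define L where "L = ln (1 + 2 * \<epsilon>\<^sup>2)"
  have L: "0 < L" "L \<le> 2" "exp L = 1 + 2 * \<epsilon>\<^sup>2"
    using \<epsilon> \<open>\<epsilon>\<^sup>2 < 1\<close> ln_add_one_self_le_self[of "2 * \<epsilon>\<^sup>2"]
    by (auto simp: L_def add_pos_nonneg intro!: ln_gt_zero)
  \<comment> \<open>From \<open>L \<le> 2 \<le> n - 1\<close>. Nonnegativity of \<open>c\<close>
    later keeps \<open>t\<close> above \<open>w / 2 * ln d\<close>.\<close>
  have "(real n - 1) / L \<ge> 1" using n L by (simp add: field_simps)
  then have c: "c \<ge> 0" "exp (- (2 * c)) = L / (real n - 1)"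
    by (auto simp: c_def L_def[symmetric] exp_minus)
  \<comment> \<open>This dominates the tail \<open>n ^ d / 4 ^ t\<close>:
    \<open>w \<ge> 2 * d / 3\<close> gives \<open>t \<ge> d * ln d / 3\<close>, and
    \<open>ln 4 \<ge> 1\<close>.\<close>
  have "((\<lambda>d. exp (real d * ln (real n) - real d * ln (real d) / 3)) \<longlongrightarrow> 0) sequentially"
    by real_asymp
  then have "\<forall>\<^sub>F d in sequentially. exp (real d * ln (real n) - real d * ln (real d) / 3) < 2 * \<epsilon>\<^sup>2"
    using \<epsilon> by (intro order_tendstoD) auto
  moreover have "\<forall>\<^sub>F d in sequentially. d \<ge> (2 :: nat)"
    by (rule eventually_ge_at_top)
  ultimately show ?thesis
  proof eventually_elim
    case (elim d)
    define w where "w = real d * (real n - 1) / real n"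
    define t where "t = nat \<lceil>w / 2 * ln (real d) + c * w\<rceil>"
    have "real d * (2 / 3) \<le> real d * ((real n - 1) / real n)"
      using n by (intro mult_left_mono) (auto simp: field_simps)
    then have w_ge: "w \<ge> real d * (2 / 3)" by (simp add: w_def)
    then have w1: "w \<ge> 1" using elim(2) by simp
    have lnd: "ln (real d) \<ge> 0" using elim(2) by simp
    have pos: "w / 2 * ln (real d) + c * w \<ge> 0" using w1 lnd c by simp
    have t_ge: "real t \<ge> w / 2 * ln (real d) + c * w"
      using pos by (simp add: t_def)
    have t_le: "real t \<le> w / 2 * ln (real d) + c * w + 1"
      using pos unfolding t_def by linarith
    have tv: "tv_dist (rook_states d n) (rook_pow d n t x) (rook_stat d n) \<le> \<epsilon>"
      if x: "x \<in> rook_states d n" for x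
    proof -
      have "real d * ln (real d) / 3 \<le> w / 2 * ln (real d)"
        using mult_right_mono[OF w_ge lnd] by simp
      also have "\<dots> \<le> real t" using t_ge mult_nonneg_nonneg[of c w] w1 c(1) by linarith
      also have "\<dots> \<le> real t * ln 4"
        using ln_ge_iff[of 4 1] exp_le by (simp add: mult_le_cancel_left1)
      finally have "exp (real d * ln (real n) - real t * ln 4)
          \<le> exp (real d * ln (real n) - real d * ln (real d) / 3)"
        by simp
      moreover have "exp (real d * ln (real n) - real t * ln 4) = real n ^ d / 4 ^ t"
        using n by (simp add: exp_diff exp_of_nat_mult)
      ultimately have tail: "real n ^ d / 4 ^ t \<le> 2 * \<epsilon>\<^sup>2" using elim(1) by linarith
      have "- 2 * real t * real n / (real d * (real n - 1)) = - (2 * real t / w)"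
        by (simp add: w_def)
      \<comment> \<open>The \<open>ln d\<close> cancels the factor \<open>d\<close> of the exponent,
        and \<open>2 * c\<close> turns \<open>n - 1\<close> into \<open>L\<close>.\<close>
      also have "\<dots> \<le> - (ln (real d) + 2 * c)"
        using t_ge w1 by (simp add: field_simps)
      finally have "exp (- 2 * real t * real n / (real d * (real n - 1)))
          \<le> exp (- ln (real d)) * exp (- (2 * c))"
        by (simp add: exp_add[symmetric])
      also have "\<dots> = L / (real d * (real n - 1))"
        unfolding c(2) exp_minus[of "ln (real d)"] inverse_eq_divide using elim(2) by simp
      finally have "exp (- 2 * real t * real n / (real d * (real n - 1)))
          \<le> L / (real d * (real n - 1))" .
      moreover have "0 < real d * (real n - 1)" using n elim(2) by simp
      ultimately have "real d * (real n - 1) * exp (- 2 * real t * real n / (real d * (real n - 1))) \<le> L"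
        by (subst mult.commute) (simp only: pos_le_divide_eq)
      then have "exp (real d * (real n - 1) * exp (- 2 * real t * real n / (real d * (real n - 1))))
          \<le> 1 + 2 * \<epsilon>\<^sup>2"
        unfolding L(3)[symmetric] by (simp only: exp_le_cancel_iff)
      moreover have "d > 0" using elim(2) by simp
      moreover have "(2 * \<epsilon>)\<^sup>2 = 4 * \<epsilon>\<^sup>2" by (simp add: power_mult_distrib)
      ultimately have "(2 * tv_dist (rook_states d n) (rook_pow d n t x) (rook_stat d n))\<^sup>2 \<le> (2 * \<epsilon>)\<^sup>2"
        using rook_tv_upper[OF n \<open>d > 0\<close> x, of t] tail by linarith
      then have "2 * tv_dist (rook_states d n) (rook_pow d n t x) (rook_stat d n) \<le> 2 * \<epsilon>"
        by (rule power2_le_imp_le) (use \<epsilon>(1) in simp)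
      then show ?thesis by simp
    qed
    have t_le': "real t \<le> w / 2 * ln (real d) + (c + 1) * w"
      using t_le w1 unfolding distrib_right[of c 1 w] by linarith
    have "ereal_of_enat (rook_mixing_time d n \<epsilon>)
        \<le> ereal (w / 2 * ln (real d) + (c + 1) * w)"
      unfolding rook_mixing_time_def using n
      by (intro mixing_time_le[OF finite_rook_states _ tv t_le'] rook_states_nonempty) simp
    then show ?case by (simp add: w_def mult_ac)
  qed
qed

text \<open>With \<open>u\<close> the spectral gap, the distance is at least
  \<open>1 - 4 * u / (1 - u) ^ (2 * t)\<close>. Here \<open>4 * u \<le> 6 / d\<close>, and the
  second-order error in \<open>ln (1 - u)\<close> costs at most a factor 2, giving 12; the constant
  13 leaves room for a strict inequality.\<close>

lemma rook_mixing_time_lower: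
  fixes n :: nat and \<epsilon> :: real
  assumes n: "n \<ge> 3" and \<epsilon>: "0 < \<epsilon>" "\<epsilon> < 1"
  defines "c \<equiv> - ln (13 / (1 - \<epsilon>)) / 2"
  shows "\<forall>\<^sub>F d in sequentially. ereal (real d * (real n - 1) / (2 * real n) * ln (real d)
        + c * (real d * (real n - 1) / real n))
    \<le> ereal_of_enat (rook_mixing_time d n \<epsilon>)"
proof -
  have "13 / (1 - \<epsilon>) \<ge> 1" using \<epsilon> by (simp add: field_simps)
  then have c: "c \<le> 0" "exp (- (2 * c)) = 13 / (1 - \<epsilon>)"
    using \<epsilon> by (auto simp: c_def)
  \<comment> \<open>Bounds \<open>2 * u * ln d\<close>, as
    \<open>u \<le> 3 / (2 * d)\<close>.\<close>
  have "((\<lambda>d. 3 * ln (real d) / real d) \<longlongrightarrow> 0) sequentially"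
    by real_asymp
  then have "\<forall>\<^sub>F d in sequentially. 3 * ln (real d) / real d < ln 2"
    by (intro order_tendstoD) auto
  moreover have "\<forall>\<^sub>F d in sequentially. d \<ge> (3 :: nat)"
    by (rule eventually_ge_at_top)
  ultimately show ?thesis
  proof eventually_elim
    case (elim d)
    define w where "w = real d * (real n - 1) / real n"
    define u where "u = real n / (real d * (real n - 1))"
    have w: "w > 0" "w * u = 1" using n elim(2) by (auto simp: w_def u_def)
    have "real n / (real n - 1) \<le> 3 / 2" using n by (simp add: field_simps)
    then have "real n / (real n - 1) / real d \<le> 3 / 2 / real d"
      by (intro divide_right_mono) auto
    then have u_le: "u \<le> 3 / (2 * real d)" by (simp add: u_def mult.commute)
    \<comment> \<open>Used twice: for the eigenvalue hypothesis of \<open>rook_tv_lower\<close> and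
      for the lower bound on \<open>ln (1 - u)\<close>.\<close>
    also have "\<dots> \<le> 1 / 2" using elim(2) by (simp add: field_simps)
    finally have u: "0 < u" "u \<le> 1 / 2" using n elim(2) by (auto simp: u_def)
    have lnd: "ln (real d) \<ge> 0" using elim(2) by simp
    have l: "rook_eigenvalue d n 1 = 1 - u" by (simp add: rook_eigenvalue_def u_def)
    obtain x where x: "x \<in> rook_states d n"
      using rook_states_nonempty[of n d] n by auto
    have "tv_dist (rook_states d n) (rook_pow d n t x) (rook_stat d n) > \<epsilon>"
      if t: "real t < w / 2 * ln (real d) + c * w" for t
    proof -
      have "2 * u * ln (real d) \<le> 2 * (3 / (2 * real d)) * ln (real d)"
        using u_le lnd by (intro mult_right_mono) auto
      also have "\<dots> \<le> ln 2" using elim(1) by simp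
      finally have small: "2 * u * ln (real d) \<le> ln 2" .
      \<comment> \<open>The form \<open>u + 2 * u\<^sup>2\<close> matches the estimate
        \<open>ln (1 - u) \<ge> - u - 2 * u\<^sup>2\<close>.\<close>
      have "2 * real t * (u + 2 * u\<^sup>2) \<le> 2 * (w / 2 * ln (real d) + c * w) * (u + 2 * u\<^sup>2)"
        using t u by (intro mult_right_mono) auto
      also have "\<dots> = (w * u) * (1 + 2 * u) * (ln (real d) + 2 * c)"
        by (simp add: power2_eq_square algebra_simps)
      also have "\<dots> = ln (real d) + 2 * c + 2 * u * ln (real d) + 4 * u * c"
        unfolding w(2) by (simp add: algebra_simps)
      also have "\<dots> \<le> ln (real d) + 2 * c + ln 2"
        using small u c(1) mult_nonneg_nonpos[of "4 * u" c] by linarith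
      finally have "2 * real t * (u + 2 * u\<^sup>2) \<le> ln (real d) + 2 * c + ln 2" .
      moreover have "2 * real t * (- u - 2 * u\<^sup>2) \<le> 2 * real t * ln (1 - u)"
        using u by (intro mult_left_mono ln_one_minus_pos_lower_bound) auto
      ultimately have "- ln (real d) + (- (2 * c)) + (- ln 2) \<le> real (2 * t) * ln (1 - u)"
        by (simp add: algebra_simps)
      then have "exp (- ln (real d) + (- (2 * c)) + (- ln 2)) \<le> exp (real (2 * t) * ln (1 - u))"
        by (simp only: exp_le_cancel_iff)
      also have "\<dots> = (1 - u) ^ (2 * t)"
        using u by (simp only: exp_of_nat_mult) simp
      also have "exp (- ln (real d) + (- (2 * c)) + (- ln 2)) = 13 / (2 * real d * (1 - \<epsilon>))"
        unfolding exp_add c(2) using elim(2) by (simp add: exp_minus field_simps)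
      finally have pow: "13 / (2 * real d * (1 - \<epsilon>)) \<le> (1 - u) ^ (2 * t)" .
      have "13 / (2 * real d * (1 - \<epsilon>)) > 0" using elim(2) \<epsilon> by simp
      then have "4 * u / (1 - u) ^ (2 * t) \<le> 4 * u / (13 / (2 * real d * (1 - \<epsilon>)))"
        using pow u by (intro divide_left_mono mult_pos_pos) auto
      also have "\<dots> \<le> 4 * (3 / (2 * real d)) / (13 / (2 * real d * (1 - \<epsilon>)))"
        using u_le elim(2) \<epsilon> by (intro divide_right_mono mult_left_mono) auto
      also have "\<dots> = 12 / 13 * (1 - \<epsilon>)" using elim(2) by simp
      also have "\<dots> < 1 - \<epsilon>" using \<epsilon> by simp
      finally have "4 * u / (1 - u) ^ (2 * t) < 1 - \<epsilon>" .
      moreover have "1 - tv_dist (rook_states d n) (rook_pow d n t x) (rook_stat d n)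
          \<le> 4 * u / (1 - u) ^ (2 * t)"
        using rook_tv_lower[of n d x t] n elim(2) x u by (simp only: l) (simp add: u_def)
      ultimately show ?thesis by linarith
    qed
    then have "ereal (w / 2 * ln (real d) + c * w) \<le> ereal_of_enat (rook_mixing_time d n \<epsilon>)"
      unfolding rook_mixing_time_def by (intro mixing_time_ge[OF _ x]) auto
    then show ?case by (simp add: w_def mult_ac)
  qed
qed

theorem theorem2:
  fixes n :: nat
  assumes "n \<ge> 3"
  shows "has_cutoff (\<lambda>d. rook_mixing_time d n)
           (\<lambda>d. real d * (real n - 1) / (2 * real n) * ln (real d))
           (\<lambda>d. real d * (real n - 1) / real n)"
  unfolding has_cutoff_def
proof (intro conjI exI ballI)
  \<comment> \<open>For fixed \<open>n\<close> both functions are multiples of \<open>d\<close> and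
    \<open>d * ln d\<close> by positive constants.\<close>
  define a where "a = (real n - 1) / real n"
  have a: "a > 0" using assms by (simp add: a_def)
  then have "(\<lambda>d. real d * a) \<in> o(\<lambda>d. real d * a / 2 * ln (real d))"
    by real_asymp
  then show "(\<lambda>d. real d * (real n - 1) / real n)
      \<in> o(\<lambda>d. real d * (real n - 1) / (2 * real n) * ln (real d))"
    by (simp add: a_def mult.commute)
next
  fix \<epsilon> :: real
  assume "\<epsilon> \<in> {0<..<1}"
  then have \<epsilon>: "0 < \<epsilon>" "\<epsilon> < 1" by auto
  \<comment> \<open>This fixes the witnesses for \<open>cl\<close> and \<open>cu\<close>; as
    \<open>n\<close> is fixed, \<open>cu\<close> may involve it.\<close>
  show "\<forall>\<^sub>F d in sequentially.
      ereal (real d * (real n - 1) / (2 * real n) * ln (real d)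
        + (- ln (13 / (1 - \<epsilon>)) / 2) * (real d * (real n - 1) / real n))
        \<le> ereal_of_enat (rook_mixing_time d n \<epsilon>) \<and>
      ereal_of_enat (rook_mixing_time d n \<epsilon>)
        \<le> ereal (real d * (real n - 1) / (2 * real n) * ln (real d)
        + (ln ((real n - 1) / ln (1 + 2 * \<epsilon>\<^sup>2)) / 2 + 1) * (real d * (real n - 1) / real n))"
    using rook_mixing_time_lower[OF assms \<epsilon>] rook_mixing_time_upper[OF assms \<epsilon>]
    by (rule eventually_conj)
qed

end
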